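(* Let $n$ be a natural number, $O$ an arbitrary oracle (finite list of triples $(C,C',\pi)$ with $C,C'$ comparator networks and $\pi$ a finite list of natural numbers), and $R$ a finite list of comparator networks such that: $R$ is size complete for $n$ channels; every element of $R$ is standard on $n$ channels; no element of $R$ has a redundant comparator; and all elements of $R$ have the same size. Then $\mathrm{Prune}(O,R,n)$ is size complete for $n$ channels.
   Context: A comparator is a pair $(i,j)$ of natural numbers; a comparator network is a finite list of comparators, and its size is the number of comparators. $C_1;C_2$ denotes concatenation. A network $C$ is a network on $n$ channels if every comparator $(i,j)$ in it has $i<n$, $j<n$, $i\neq j$; it is standard on $n$ channels if every comparator $(i,j)$ in it has $i<j<n$. For $\vec x=(x_0,\ldots,x_{n-1})\in\{0,1\}^n$, applying comparator $(i,j)$ leaves $\vec x$ unchanged if $x_i\le x_j$ and otherwise swaps the entries at positions $i$ and $j$; $C(\vec x)$ is the result of applying the comparators of $C$ in order, and $\mathsf{outputs}(C)=\{C(\vec x):\vec x\in\{0,1\}^n\}$. $C$ is a sorting network on $n$ channels if it is a network on $n$ channels and $C(\vec x)$ is nondecreasing for all $\vec x\in\{0,1\}^n$. A comparator $c=(i,j)$ is redundant after $C_1$ if $C_1(\vec x)_i\le C_1(\vec x)_j$ for every $\vec x\in\{0,1\}^n$. A network $D$ has no redundant comparators if whenever $D=C_1;c;C_2$, $c$ is not redundant after $C_1$. A list $R$ of networks is size complete for $n$ channels if for every $k$: whenever there exists a sorting network on $n$ channels of size $k$, there exist $C'\in R$ and a network $C''$ such that $C';C''$ is standard on $n$ channels,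 has no redundant comparators, is a sorting network on $n$ channels, and has size at most $k$. A list $\pi=[\pi_0,\ldots,\pi_{m-1}]$ of naturals represents a permutation of $\{0,\ldots,n-1\}$ if $m=n$, all $\pi_i<n$ and the $\pi_i$ are pairwise distinct; it then acts on $\vec x\in\{0,1\}^n$ by $\pi(\vec x)=\vec y$ with $y_{\pi_i}=x_i$. For such $\pi$, $C\le_\pi C'$ means $\{\pi(\vec x):\vec x\in\mathsf{outputs}(C)\}\subseteq\mathsf{outputs}(C')$. $\mathrm{Prune}(O,R,n)$ is defined recursively: if $O$ is empty, return $R$; if $O=(C,C',\pi)::O'$, then if $C=C'$, or $C\notin R$, or $\pi$ does not represent a permutation of $\{0,\ldots,n-1\}$, or not $C\le_\pi C'$, return $R$; otherwise return $\mathrm{Prune}(O',R\setminus C',n)$, where $R\setminus C'$ is $R$ with all occurrences of $C'$ removed. *)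

theory Defs
  imports Main
begin

type_synonym comparator = "nat \<times> nat"
type_synonym network = "comparator list"
type_synonym pruning_oracle = "(network \<times> network \<times> nat list) list"

definition channels :: "nat \<Rightarrow> network \<Rightarrow> bool" where
  "channels n C \<longleftrightarrow> (\<forall>(i, j) \<in> set C. i < n \<and> j < n \<and> i \<noteq> j)"

definition standard :: "nat \<Rightarrow> network \<Rightarrow> bool" where
  "standard n C \<longleftrightarrow> (\<forall>(i, j) \<in> set C. i < j \<and> j < n)"

text \<open>Elements of \<open>{0,1}\<^sup>n\<close> are represented by Boolean lists of length \<open>n\<close>, with
  \<open>False < True\<close> in the role of \<open>0 < 1\<close>.\<close>

definition binary_vectors :: "nat \<Rightarrow> bool list set" where
  "binary_vectors n = {x. length x = n}"

text \<open>The result of applying a comparator is meaningful only if \<open>i\<close> and \<open>j\<close> are smaller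
  than the length of \<open>x\<close>; otherwise \<open>nth\<close> reads an unspecified value.\<close>

fun apply_comparator :: "comparator \<Rightarrow> bool list \<Rightarrow> bool list" where
  "apply_comparator (i, j) x = (if x ! i \<le> x ! j then x else x[i := x ! j, j := x ! i])"

definition apply_network :: "network \<Rightarrow> bool list \<Rightarrow> bool list" where
  "apply_network C x = fold apply_comparator C x"

definition outputs :: "nat \<Rightarrow> network \<Rightarrow> bool list set" where
  "outputs n C = apply_network C ` binary_vectors n"

definition sorting_network :: "nat \<Rightarrow> network \<Rightarrow> bool" where
  "sorting_network n C \<longleftrightarrow>
     channels n C \<and> (\<forall>x \<in> binary_vectors n. sorted (apply_network C x))"

definition redundant_after :: "nat \<Rightarrow> network \<Rightarrow> comparator \<Rightarrow> bool" where
  "redundant_after n C1 c \<longleftrightarrow>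
     (\<forall>x \<in> binary_vectors n. apply_network C1 x ! fst c \<le> apply_network C1 x ! snd c)"

definition no_redundant :: "nat \<Rightarrow> network \<Rightarrow> bool" where
  "no_redundant n D \<longleftrightarrow> (\<forall>C1 c C2. D = C1 @ [c] @ C2 \<longrightarrow> \<not> redundant_after n C1 c)"

definition size_complete :: "nat \<Rightarrow> network list \<Rightarrow> bool" where
  "size_complete n R \<longleftrightarrow>
     (\<forall>k. (\<exists>C. sorting_network n C \<and> length C = k) \<longrightarrow>
       (\<exists>C' \<in> set R. \<exists>C''. standard n (C' @ C'') \<and> no_redundant n (C' @ C'') \<and>
          sorting_network n (C' @ C'') \<and> length (C' @ C'') \<le> k))"

definition is_permutation :: "nat \<Rightarrow> nat list \<Rightarrow> bool" where
  "is_permutation n \<pi> \<longleftrightarrow> length \<pi> = n \<and> (\<forall>i \<in> set \<pi>. i < n) \<and> distinct \<pi>"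

definition permute :: "nat list \<Rightarrow> bool list \<Rightarrow> bool list" where
  "permute \<pi> x = (THE y. length y = length x \<and> (\<forall>i < length x. y ! (\<pi> ! i) = x ! i))"

lemma permute_works:
  assumes \<pi>: "is_permutation (length x) \<pi>"
  shows "length (permute \<pi> x) = length x \<and> (\<forall>i < length x. permute \<pi> x ! (\<pi> ! i) = x ! i)"
proof -
  let ?n = "length x"
  have len: "length \<pi> = ?n" and dist: "distinct \<pi>" and sub: "set \<pi> \<subseteq> {..<?n}"
    using \<pi> by (auto simp: is_permutation_def)
  have set: "set \<pi> = {..<?n}"
    using sub by (rule card_subset_eq[rotated]) (simp_all add: distinct_card dist len)
  define f where "f j = (THE i. i < ?n \<and> \<pi> ! i = j)" for j
  have f: "f (\<pi> ! i) = i" if "i < ?n" for i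
    unfolding f_def using that dist len by (auto simp: nth_eq_iff_index_eq)
  have ex: "length (map (\<lambda>j. x ! f j) [0..<?n]) = ?n \<and>
      (\<forall>i < ?n. map (\<lambda>j. x ! f j) [0..<?n] ! (\<pi> ! i) = x ! i)"
    using f sub len by (auto simp: subset_iff in_set_conv_nth)
  show ?thesis
    unfolding permute_def
  proof (rule theI[where a = "map (\<lambda>j. x ! f j) [0..<?n]"], rule ex)
    fix y assume y: "length y = ?n \<and> (\<forall>i < ?n. y ! (\<pi> ! i) = x ! i)"
    show "y = map (\<lambda>j. x ! f j) [0..<?n]"
    proof (rule nth_equalityI)
      fix j assume "j < length y"
      then have "j \<in> set \<pi>" using set y by simp
      then obtain i where "i < ?n" "j = \<pi> ! i" using len by (auto simp: in_set_conv_nth)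
      then show "y ! j = map (\<lambda>j. x ! f j) [0..<?n] ! j" using y ex by simp
    qed (use y in simp)
  qed
qed

definition subsumes :: "nat \<Rightarrow> nat list \<Rightarrow> network \<Rightarrow> network \<Rightarrow> bool" where
  "subsumes n \<pi> C C' \<longleftrightarrow> permute \<pi> ` outputs n C \<subseteq> outputs n C'"

fun prune :: "pruning_oracle \<Rightarrow> network list \<Rightarrow> nat \<Rightarrow> network list" where
  "prune [] R n = R"
| "prune ((C, C', \<pi>) # Os) R n =
     (if C = C' \<or> C \<notin> set R \<or> \<not> is_permutation n \<pi> \<or> \<not> subsumes n \<pi> C C' then R
      else prune Os (removeAll C' R) n)"

end

(*
  It suffices to treat one pruning step. Let C' be removed because C \<le>_\<pi> C', and let C';E be the
  witness for C'. Renaming the channels of E by the inverse of \<pi>, and flipping on the fly the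
  comparators that point the wrong way, gives a standard F with |F| = |E| such that C;F sorts up to
  one fixed permutation of the channels. A standard network fixes sorted inputs, hence so does that
  permutation, and C;F sorts. Since C has no redundant comparator, deleting redundant
  comparators from C;F leaves the prefix C intact.
*)
theory Submission
  imports Defs "HOL-Combinatorics.Permutations"
begin

section \<open>Elementary properties of networks\<close>

lemma apply_network_append:
  "apply_network (C @ D) x = apply_network D (apply_network C x)"
  by (simp add: apply_network_def)

lemma length_apply_comparator [simp]: "length (apply_comparator c x) = length x"
  by (cases c) simp

lemma length_apply_network [simp]: "length (apply_network C x) = length x"
  unfolding apply_network_def by (induction C arbitrary: x) auto

lemma standard_append: "standard n (C @ D) \<longleftrightarrow> standard n C \<and> standard n D"
  by (auto simp: standard_def)

lemma channels_append: "channels n (C @ D) \<longleftrightarrow> channels n C \<and> channels n D"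
  by (auto simp: channels_def)

lemma standard_imp_channels: "standard n C \<Longrightarrow> channels n C"
  by (fastforce simp: standard_def channels_def)

lemma mset_apply_network:
  "channels (length x) C \<Longrightarrow> mset (apply_network C x) = mset x"
proof (induction C arbitrary: x)
  case Nil
  then show ?case by (simp add: apply_network_def)
next
  case (Cons c C)
  obtain i j where c: "c = (i, j)" by force
  have "mset (x[i := x ! j, j := x ! i]) = mset x"
    using Cons.prems by (intro mset_swap) (simp_all add: c channels_def)
  then have "mset (apply_comparator c x) = mset x"
    by (simp only: c apply_comparator.simps if_distrib[of mset] if_cancel)
  moreover have "mset (apply_network C (apply_comparator c x)) = mset (apply_comparator c x)"
    using Cons by (simp add: channels_def)
  ultimately show ?case by (simp add: apply_network_def)
qed

text \<open>Every comparator has \<open>i < j\<close>, so on a sorted vector it meets entries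
  already in order and never swaps.\<close>

lemma standard_network_fixes_sorted:
  assumes "standard (length x) C" "sorted x"
  shows "apply_network C x = x"
  using assms(1)
proof (induction C)
  case (Cons c C)
  then obtain i j where "c = (i, j)" "i < j" "j < length x"
    by (cases c) (auto simp: standard_def)
  then have "apply_comparator c x = x"
    using sorted_nth_mono[OF assms(2), of i j] by simp
  then show ?case using Cons by (simp add: apply_network_def standard_def)
qed (simp add: apply_network_def)

text \<open>On Booleans, minimum and maximum are conjunction and disjunction; this form spares a
  case split on the compared values.\<close>

lemma nth_apply_comparator:
  assumes "i < length x" "j < length x" "i \<noteq> j"
  shows "apply_comparator (i, j) x ! k =
    (if k = i then x ! i \<and> x ! j else if k = j then x ! i \<or> x ! j else x ! k)"
  using assms by (auto simp: nth_list_update)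

section \<open>Moving a permutation past a network\<close>

text \<open>Position \<open>k\<close> of \<open>permute_list p y\<close> holds
  \<open>y ! p k\<close>, so comparing positions \<open>i\<close> and \<open>j\<close> there amounts
  to comparing \<open>p i\<close> and \<open>p j\<close> in \<open>y\<close>. If this order is not
  standard, the flipped comparator is used and \<open>q\<close> absorbs the flip.\<close>

lemma permute_list_apply_comparator:
  assumes p: "p permutes {..<n}" and ij: "i < n" "j < n" "i \<noteq> j"
  shows "\<exists>c q. standard n [c] \<and> q permutes {..<n} \<and>
    (\<forall>y. length y = n \<longrightarrow>
      permute_list q (apply_comparator c y) = apply_comparator (i, j) (permute_list p y))"
proof -
  have pn: "p k < n" if "k < n" for k using permutes_in_image[OF p, of k] that by simp
  have inj: "p k = p l \<longleftrightarrow> k = l" for k l using permutes_inj[OF p] by (auto dest: injD)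
  show ?thesis
  proof (cases "p i < p j")
    case True
    have "permute_list p (apply_comparator (p i, p j) y) = apply_comparator (i, j) (permute_list p y)"
      if "length y = n" for y
      by (rule nth_equalityI)
        (use that p pn ij in
          \<open>simp_all add: permute_list_nth nth_apply_comparator inj del: apply_comparator.simps\<close>)
    then show ?thesis
      using True p pn ij by (intro exI[of _ "(p i, p j)"] exI[of _ p]) (auto simp: standard_def)
  next
    case False
    then have lt: "p j < p i" using inj[of i j] ij by linarith
    \<comment> \<open>The flipped comparator leaves the minimum at \<open>p j = q i\<close> and the
      maximum at \<open>p i = q j\<close>, so reading through \<open>q\<close> puts them at
      \<open>i\<close> and \<open>j\<close>.\<close>
    define q where "q = p \<circ> transpose i j"
    have q: "q permutes {..<n}"
      unfolding q_def by (rule permutes_compose[OF permutes_swap_id p]) (use ij in auto)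
    have "permute_list q (apply_comparator (p j, p i) y) = apply_comparator (i, j) (permute_list p y)"
      if "length y = n" for y
      by (rule nth_equalityI)
        (use that p q pn ij in
          \<open>auto simp: permute_list_nth nth_apply_comparator inj q_def transpose_def
            simp del: apply_comparator.simps\<close>)
    then show ?thesis
      using lt q pn ij by (intro exI[of _ "(p j, p i)"] exI[of _ q]) (auto simp: standard_def)
  qed
qed

text \<open>Each comparator passed may change the permutation, so the induction generalizes over
  \<open>p\<close>. The final \<open>q\<close> is the same for all inputs \<open>y\<close>.\<close>

lemma standardize_network:
  assumes "channels n G" "p permutes {..<n}"
  shows "\<exists>F q. standard n F \<and> length F = length G \<and> q permutes {..<n} \<and>
    (\<forall>y. length y = n \<longrightarrow>
      permute_list q (apply_network F y) = apply_network G (permute_list p y))"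
  using assms
proof (induction G arbitrary: p)
  case Nil
  then show ?case
    by (intro exI[of _ "[]"] exI[of _ p]) (simp add: standard_def apply_network_def)
next
  case (Cons g G)
  obtain i j where g: "g = (i, j)" by force
  with Cons.prems have ij: "i < n" "j < n" "i \<noteq> j" and G: "channels n G"
    by (auto simp: channels_def)
  obtain c r where c: "standard n [c]" and r: "r permutes {..<n}"
    and cr: "\<And>y. length y = n \<Longrightarrow>
      permute_list r (apply_comparator c y) = apply_comparator (i, j) (permute_list p y)"
    using permute_list_apply_comparator[OF Cons.prems(2) ij] by blast
  obtain F q where F: "standard n F" "length F = length G" "q permutes {..<n}"
    and Fq: "\<And>y. length y = n \<Longrightarrow>
      permute_list q (apply_network F y) = apply_network G (permute_list r y)"
    using Cons.IH[OF G r] by blast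
  have "permute_list q (apply_network (c # F) y) = apply_network (g # G) (permute_list p y)"
    if "length y = n" for y
    using Fq[of "apply_comparator c y"] cr[OF that] that by (simp add: apply_network_def g)
  then show ?case
    using c F by (intro exI[of _ "c # F"] exI[of _ q]) (auto simp: standard_def)
qed

lemma permute_list_inj:
  assumes q: "q permutes {..<length x}" and len: "length y = length x"
    and eq: "permute_list q x = permute_list q y"
  shows "x = y"
proof -
  have "permute_list (inv q) (permute_list q z) = z" if "length z = length x" for z
    using that permute_list_compose[of "inv q" z q] permutes_inv[OF q]
    by (simp add: permutes_inv_o[OF q])
  then show ?thesis using eq len by metis
qed

text \<open>Feeding \<open>H\<close> the vector \<open>sort v\<close>, which it fixes, shows that
  \<open>q\<close> fixes \<open>sort v\<close> too. Then \<open>apply_network H v\<close> and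
  \<open>sort v\<close> have the same image under the injective
  \<open>permute_list q\<close>.\<close>

lemma standard_sorting_up_to_permutation:
  assumes H: "standard n H" and q: "q permutes {..<n}"
    and s: "\<And>v. length v = n \<Longrightarrow> sorted (permute_list q (apply_network H v))"
  shows "sorting_network n H"
proof -
  have "sorted (apply_network H v)" if v: "length v = n" for v
  proof -
    \<comment> \<open>Both \<open>H\<close> and \<open>q\<close> preserve the multiset of entries,
      and the result is sorted.\<close>
    have *: "permute_list q (apply_network H u) = sort u" if "length u = n" for u
      using s[OF that] mset_apply_network[of u H] standard_imp_channels[OF H] q that
      by (intro properties_for_sort[symmetric]) auto
    have "apply_network H (sort v) = sort v"
      by (rule standard_network_fixes_sorted) (use H v in auto)
    then have "permute_list q (sort v) = sort v"
      using *[of "sort v"] v by (simp add: sorted_sort_id)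
    then have "apply_network H v = sort v"
      using permute_list_inj[of q "apply_network H v" "sort v"] *[OF v] q v by simp
    then show ?thesis by simp
  qed
  then show ?thesis
    using standard_imp_channels[OF H] by (simp add: sorting_network_def binary_vectors_def)
qed

section \<open>Extending the subsuming network\<close>

text \<open>\<open>permute\<close> writes entry \<open>i\<close> to position
  \<open>\<pi> ! i\<close>, whereas \<open>permute_list p\<close> reads position \<open>i\<close>
  from \<open>p i\<close>; hence \<open>p\<close> is the inverse of \<pi>.\<close>

lemma permute_eq_permute_list:
  assumes "is_permutation n \<pi>"
  obtains p where "p permutes {..<n}"
    "\<And>x. length x = n \<Longrightarrow> permute \<pi> x = permute_list p x"
proof -
  \<comment> \<open>Outside the channels \<pi> is continued by the identity, as
    \<open>permutes\<close> demands.\<close>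
  define f where "f i = (if i < n then \<pi> ! i else i)" for i
  have inj: "inj_on f {..<n}" and "f ` {..<n} \<subseteq> {..<n}"
    using assms by (auto simp: is_permutation_def f_def inj_on_def nth_eq_iff_index_eq)
  then have "bij_betw f {..<n} {..<n}"
    by (simp add: bij_betw_def endo_inj_surj)
  then have f: "f permutes {..<n}"
    by (rule bij_imp_permutes) (simp add: f_def)
  have "permute \<pi> x = permute_list (inv f) x" if x: "length x = n" for x
  proof -
    have l: "length (permute \<pi> x) = n"
      and nth: "\<And>i. i < n \<Longrightarrow> permute \<pi> x ! (\<pi> ! i) = x ! i"
      using permute_works[of x \<pi>] assms x by auto
    have "permute_list f (permute \<pi> x) = x"
      by (rule nth_equalityI) (use f l nth x in \<open>auto simp: permute_list_nth f_def\<close>)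
    then show ?thesis
      using permute_list_compose[of "inv f" "permute \<pi> x" f] permutes_inv[OF f] l
      by (simp add: permutes_inv_o[OF f])
  qed
  then show ?thesis using that permutes_inv[OF f] by blast
qed

lemma subsumes_sorting_extension:
  assumes C: "standard n C" and \<pi>: "is_permutation n \<pi>" and sub: "subsumes n \<pi> C C'"
    and sn: "sorting_network n (C' @ E)"
  shows "\<exists>F. length F = length E \<and> standard n (C @ F) \<and> sorting_network n (C @ F)"
proof -
  obtain p where p: "p permutes {..<n}"
    and pl: "\<And>x. length x = n \<Longrightarrow> permute \<pi> x = permute_list p x"
    using permute_eq_permute_list[OF \<pi>] by blast
  obtain F q where F: "standard n F" "length F = length E" "q permutes {..<n}"
    and Fq: "\<And>y. length y = n \<Longrightarrow>
      permute_list q (apply_network F y) = apply_network E (permute_list p y)"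
    using standardize_network[OF _ p, of E] sn
    by (auto simp: sorting_network_def channels_append)
  have st: "standard n (C @ F)" using C F by (simp add: standard_append)
  have "sorted (permute_list q (apply_network (C @ F) v))" if v: "length v = n" for v
  proof -
    \<comment> \<open>By subsumption the permuted output of \<open>C\<close> is some
      \<open>apply_network C' u\<close>, which \<open>E\<close> sorts; \<open>F\<close> followed by
      \<open>q\<close> gives the same vector.\<close>
    have "permute \<pi> (apply_network C v) \<in> outputs n C'"
      using sub v by (auto simp: subsumes_def outputs_def binary_vectors_def)
    then obtain u where "length u = n" "permute_list p (apply_network C v) = apply_network C' u"
      using pl v by (auto simp: outputs_def binary_vectors_def)
    then show ?thesis
      using sn v Fq[of "apply_network C v"]
      by (auto simp: sorting_network_def binary_vectors_def apply_network_append)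
  qed
  then have "sorting_network n (C @ F)"
    using standard_sorting_up_to_permutation[OF st F(3)] by blast
  then show ?thesis using st F(2) by blast
qed

section \<open>Deleting redundant comparators\<close>

lemma remove_redundant_comparator:
  assumes "redundant_after n C1 c" "length x = n"
  shows "apply_network (C1 @ [c] @ C2) x = apply_network (C1 @ C2) x"
  using assms
  by (cases c) (auto simp: redundant_after_def binary_vectors_def apply_network_def)

text \<open>Redundancy depends only on the comparators placed before, so one found in
  \<open>C @ F\<close> cannot lie in \<open>C\<close>. Deleting it shortens \<open>F\<close>, which
  drives the induction.\<close>

lemma remove_redundant_keeping_prefix:
  assumes "no_redundant n C" "standard n (C @ F)" "sorting_network n (C @ F)"
  shows "\<exists>F'. length F' \<le> length F \<and> standard n (C @ F') \<and> no_redundant n (C @ F') \<and>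
    sorting_network n (C @ F')"
  using assms(2,3)
proof (induction "length F" arbitrary: F rule: less_induct)
  case less
  show ?case
  proof (cases "no_redundant n (C @ F)")
    case True
    then show ?thesis using less.prems by blast
  next
    case False
    then obtain C1 c C2 where eq: "C @ F = C1 @ c # C2" and red: "redundant_after n C1 c"
      by (auto simp: no_redundant_def)
    have "\<exists>G. C1 = C @ G \<and> F = G @ c # C2"
    proof -
      from eq consider U where "C1 = C @ U" "F = U @ c # C2"
        | U where "C = C1 @ U" "U @ F = c # C2"
        by (auto simp: append_eq_append_conv2)
      then show ?thesis
      proof cases
        \<comment> \<open>If \<open>U\<close> is empty, \<open>F\<close> starts with
          \<open>c\<close>; otherwise \<open>c\<close> is a redundant comparator of
          \<open>C\<close>, a contradiction.\<close>
        case (2 U)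
        then show ?thesis
          using assms(1) red by (cases U) (force simp: no_redundant_def)+
      qed blast
    qed
    then obtain G where G: "C1 = C @ G" "F = G @ c # C2" by blast
    have "standard n (C @ (G @ C2))"
      using less.prems(1) G by (auto simp: standard_def)
    moreover have "sorting_network n (C @ (G @ C2))"
      using less.prems(2) remove_redundant_comparator[OF red, of _ C2] G
      by (auto simp: sorting_network_def channels_def binary_vectors_def)
    moreover have "length (G @ C2) < length F" using G by simp
    ultimately show ?thesis
      using less.hyps[of "G @ C2"] by (meson le_trans less_imp_le)
  qed
qed

section \<open>Pruning\<close>

text \<open>Only a witness with prefix \<open>C'\<close> is lost, and one with prefix
  \<open>C\<close> replaces it. The length premise is conditional because an oracle may name a
  \<open>C'\<close> outside \<open>R\<close>.\<close>

lemma size_complete_removeAll: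
  assumes "size_complete n R" "C \<in> set R" "C' \<in> set R \<Longrightarrow> length C = length C'" "C \<noteq> C'"
    and "standard n C" "no_redundant n C" "is_permutation n \<pi>" "subsumes n \<pi> C C'"
  shows "size_complete n (removeAll C' R)"
  unfolding size_complete_def
proof (intro allI impI)
  fix k assume "\<exists>D. sorting_network n D \<and> length D = k"
  then obtain D E where D: "D \<in> set R" "standard n (D @ E)" "no_redundant n (D @ E)"
    "sorting_network n (D @ E)" "length (D @ E) \<le> k"
    using assms(1) unfolding size_complete_def by blast
  show "\<exists>D\<in>set (removeAll C' R). \<exists>E. standard n (D @ E) \<and> no_redundant n (D @ E) \<and>
      sorting_network n (D @ E) \<and> length (D @ E) \<le> k"
  proof (cases "D = C'")
    case False
    then show ?thesis using D by auto
  next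
    case True
    obtain F where F: "length F = length E" "standard n (C @ F)" "sorting_network n (C @ F)"
      using subsumes_sorting_extension[OF assms(5,7,8)] D(4) True by blast
    obtain F' where "length F' \<le> length F" "standard n (C @ F')" "no_redundant n (C @ F')"
      "sorting_network n (C @ F')"
      using remove_redundant_keeping_prefix[OF assms(6) F(2,3)] by blast
    \<comment> \<open>The prefixes \<open>C\<close> and \<open>C' = D\<close> have equal length, and
      \<open>F'\<close> is at most as long as \<open>E\<close>.\<close>
    moreover have "length (C @ F') \<le> k"
      using calculation(1) F(1) D(1,5) True assms(3) by simp
    ultimately show ?thesis using assms(2,4) by auto
  qed
qed

theorem mainTheorem5:
  fixes n :: nat and Os :: pruning_oracle and R :: "network list"
  assumes "size_complete n R"
    and "\<forall>C \<in> set R. standard n C"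
    and "\<forall>C \<in> set R. no_redundant n C"
    and "\<forall>C \<in> set R. \<forall>C' \<in> set R. length C = length C'"
  shows "size_complete n (prune Os R n)"
  using assms
proof (induction Os R n rule: prune.induct)
  case (2 C C' \<pi> Os R n)
  show ?case
  proof (cases "C = C' \<or> C \<notin> set R \<or> \<not> is_permutation n \<pi> \<or> \<not> subsumes n \<pi> C C'")
    case False
    then have "size_complete n (removeAll C' R)"
      using size_complete_removeAll[of n R C C' \<pi>] "2.prems" by blast
    \<comment> \<open>The remaining hypotheses quantify over members of \<open>R\<close> and so pass
      to \<open>removeAll C' R\<close>.\<close>
    then have "size_complete n (prune Os (removeAll C' R) n)"
      using "2.IH"[OF False] "2.prems" by simp
    then show ?thesis using False by simp
  qed (use "2.prems" in auto)
qed simp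

end
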